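(* Consider the Riemann problem of the kinematic wave model of diverging traffic with one upstream link $0$ and two downstream links $1,2$, with initial states $U_0=(D_0,S_0)$ on link $0$ and $U_i=(D_i,S_i)$ on link $i$ ($i=1,2$). The stationary and interior states satisfying the entropy condition $$q_i=\min\left\{1,\ \frac{D_0(0^-,t)}{S_1(0^+,t)+S_2(0^+,t)}\right\}S_i(0^+,t),\quad i=1,2,$$ the traffic conservation equations, and the admissible conditions on stationary and interior states are the following. 1. When $S_1+S_2<D_0$: $U_i^+=U_i(0^+,t)=(C_i,S_i)$ ($i=1,2$) and $U_0^-=U_0(0^-,t)=(C_0,S_1+S_2)$. 2. When $S_1+S_2=D_0$: $U_i^+=U_i(0^+,t)=(C_i,S_i)$ ($i=1,2$), $U_0^-=(D_0,C_0)$, and $U_0(0^-,t)=(D_0,C_0)$ or, when $D_0<C_0$, $U_0(0^-,t)=(D_0(0^-,t),S_0(0^-,t))$ with $D_0(0^-,t)\ge D_0$ and $S_0(0^-,t)>D_0$. 3. When $S_i>\frac{C_i}{C_1+C_2}D_0$ for $i=1,2$: $U_0^-=U_0(0^-,t)=(D_0,C_0)$ and $U_i^+=U_i(0^+,t)=\left(\frac{C_i}{C_1+C_2}D_0,\ C_i\right)$ for $i=1,2$. 4. When $S_1+S_2>D_0$ and $S_i\le\frac{C_i}{C_1+C_2}D_0$ (where $\{i,j\}=\{1,2\}$): $U_0^-=U_0(0^-,t)=(D_0,C_0)$, $U_i^+=(C_i,S_i)$, $U_i(0^+,t)=\left(C_i,\ \frac{C_j}{D_0-S_i}S_i\right)$,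 and $U_j^+=U_j(0^+,t)=(D_0-S_i,\ C_j)$.
   Context: Network and model. A diverge has one upstream link $0$ (coordinate $x_0\in(-\infty,0)$) and two downstream links $1,2$ (coordinates $x_i\in(0,\infty)$), meeting at $x=0$. In this model vehicles have no predefined routes and belong to the same commodity. Each link $a$ is homogeneous with a unimodal flow-density relation $q=Q_a(\rho)=\rho V_a(\rho)$, critical density $\rho_{c,a}$, and capacity $C_a=Q_a(\rho_{c,a})>0$; traffic on link $a$ obeys $\partial_t\rho+\partial_x Q_a(\rho)=0$. The Riemann problem has constant initial density on each link. Supply-demand space. Demand and supply on link $a$ are $D(\rho)=Q_a(\min\{\rho,\rho_{c,a}\})$ and $S(\rho)=Q_a(\max\{\rho,\rho_{c,a}\})$. A traffic state on link $a$ is represented as a pair $U=(D,S)$ with $0\le D,S\le C_a$ and $\max\{D,S\}=C_a$; its flow-rate is $q(U)=\min\{D,S\}$. A state is under-critical (UC) if $S=C_a$, over-critical (OC) if $D=C_a$, strictly under-critical (SUC) if $D<S=C_a$, strictly over-critical (SOC) if $S<D=C_a$. The initial states are $U_0=(D_0,S_0)$ and $U_i=(D_i,S_i)$. Unknowns (for $t>0$): stationary states $U_0^-=(D_0^-,S_0^-)$ on link $0$ and $U_i^+=(D_i^+,S_i^+)$ on link $i$; interior states at the junction $U_0(0^-,t)=(D_0(0^-,t),S_0(0^-,t))$ (a state on link $0$) and $U_i(0^+,t)=(D_i(0^+,t),S_i(0^+,t))$ (a state on link $i$), $i=1,2$. Boundary fluxes and traffic conservation: $q_0=q(U_0^-)$,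 $q_i=q(U_i^+)$, $q_0=q_1+q_2$. Admissible conditions for stationary states: $U_0^-=(D_0,C_0)$, or $U_0^-=(C_0,S_0^-)$ with $S_0^-<D_0$; and $U_i^+=(C_i,S_i)$, or $U_i^+=(D_i^+,C_i)$ with $D_i^+<S_i$. Admissible conditions for interior states: if $U_0^-$ is SOC then $U_0(0^-,t)=U_0^-$; if $U_0^-$ is UC then $U_0(0^-,t)$ is any state on link $0$ with $S_0(0^-,t)\ge D_0^-$; if $U_i^+$ is SUC then $U_i(0^+,t)=U_i^+$; if $U_i^+$ is OC then $U_i(0^+,t)$ is any state on link $i$ with $D_i(0^+,t)\ge S_i^+$. Convention: in the entropy condition, $q_1=q_2=0$ if $S_1(0^+,t)=S_2(0^+,t)=0$.
   Formalization: The list omits some solutions, added here: if S_1+S_2=D_0, also U_0(0^-)=(C_0,D_0), or U_0(0^-)=(D_0,C_0) with S_i(0^+) scaled up proportionally; if S_i=C_iD_0/(C_1+C_2) in case 4, also any U_i(0^+) with D_i(0^+)≥S_i and S_i(0^+)=C_i (any state if D_0=0). *)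

theory Defs
  imports Complex_Main
begin

text \<open>
  Links are numbered by naturals: \<open>0\<close> is upstream, \<open>1\<close> and \<open>2\<close> are downstream. Data of a link
  at an index outside \<open>{0, 1, 2}\<close> plays no role.
\<close>

definition flow_density :: "(real \<Rightarrow> real) \<Rightarrow> real \<Rightarrow> real" where
  "flow_density V \<rho> = \<rho> * V \<rho>"

text \<open>
  A jam density, if there is one, is accommodated by letting \<open>V\<close> vanish from there on. Monotonicity
  is not required to be strict.
\<close>

definition unimodal_link :: "(real \<Rightarrow> real) \<Rightarrow> real \<Rightarrow> bool" where
  "unimodal_link V \<rho>c \<longleftrightarrow>
     0 \<le> \<rho>c \<and> (\<forall>\<rho>\<ge>0. 0 \<le> V \<rho>) \<and>
     mono_on {0..\<rho>c} (flow_density V) \<and> antimono_on {\<rho>c..} (flow_density V)"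

definition capacity :: "(real \<Rightarrow> real) \<Rightarrow> real \<Rightarrow> real" where
  "capacity V \<rho>c = flow_density V \<rho>c"

definition demand_of :: "(real \<Rightarrow> real) \<Rightarrow> real \<Rightarrow> real \<Rightarrow> real" where
  "demand_of V \<rho>c \<rho> = flow_density V (min \<rho> \<rho>c)"

definition supply_of :: "(real \<Rightarrow> real) \<Rightarrow> real \<Rightarrow> real \<Rightarrow> real" where
  "supply_of V \<rho>c \<rho> = flow_density V (max \<rho> \<rho>c)"

text \<open>Points \<open>(D, S)\<close> of the supply-demand space. Below, \<open>C\<close> is the capacity of the link.\<close>

type_synonym state = "real \<times> real"

abbreviation dem :: "state \<Rightarrow> real" where "dem \<equiv> fst"
abbreviation spl :: "state \<Rightarrow> real" where "spl \<equiv> snd"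

definition traffic_state :: "real \<Rightarrow> state \<Rightarrow> bool" where
  "traffic_state C U \<longleftrightarrow>
     0 \<le> dem U \<and> dem U \<le> C \<and> 0 \<le> spl U \<and> spl U \<le> C \<and> max (dem U) (spl U) = C"

definition flow_rate :: "state \<Rightarrow> real" where
  "flow_rate U = min (dem U) (spl U)"

definition UC :: "real \<Rightarrow> state \<Rightarrow> bool" where "UC C U \<longleftrightarrow> spl U = C"
definition OC :: "real \<Rightarrow> state \<Rightarrow> bool" where "OC C U \<longleftrightarrow> dem U = C"
definition SUC :: "real \<Rightarrow> state \<Rightarrow> bool" where "SUC C U \<longleftrightarrow> dem U < spl U \<and> spl U = C"
definition SOC :: "real \<Rightarrow> state \<Rightarrow> bool" where "SOC C U \<longleftrightarrow> spl U < dem U \<and> dem U = C"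

definition stationary_upstream :: "real \<Rightarrow> state \<Rightarrow> state \<Rightarrow> bool" where
  "stationary_upstream C U Um \<longleftrightarrow>
     traffic_state C Um \<and> (Um = (dem U, C) \<or> (\<exists>s. Um = (C, s) \<and> s < dem U))"

definition stationary_downstream :: "real \<Rightarrow> state \<Rightarrow> state \<Rightarrow> bool" where
  "stationary_downstream C U Up \<longleftrightarrow>
     traffic_state C Up \<and> (Up = (C, spl U) \<or> (\<exists>d. Up = (d, C) \<and> d < spl U))"

definition interior_upstream :: "real \<Rightarrow> state \<Rightarrow> state \<Rightarrow> bool" where
  "interior_upstream C Um Ui \<longleftrightarrow>
     traffic_state C Ui \<and> (SOC C Um \<longrightarrow> Ui = Um) \<and> (UC C Um \<longrightarrow> spl Ui \<ge> dem Um)"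

definition interior_downstream :: "real \<Rightarrow> state \<Rightarrow> state \<Rightarrow> bool" where
  "interior_downstream C Up Ui \<longleftrightarrow>
     traffic_state C Ui \<and> (SUC C Up \<longrightarrow> Ui = Up) \<and> (OC C Up \<longrightarrow> dem Ui \<ge> spl Up)"

text \<open>The flux that the entropy condition prescribes into the link with interior supply \<open>s\<close>.\<close>

definition entropy_flux :: "real \<Rightarrow> real \<Rightarrow> real \<Rightarrow> real \<Rightarrow> real" where
  "entropy_flux d s1 s2 s =
     (if s1 = 0 \<and> s2 = 0 then 0 else min 1 (d / (s1 + s2)) * s)"

text \<open>
  \<open>U a\<close> is the initial state, \<open>Us a\<close> the stationary state (\<open>U\<^sub>0\<^sup>-\<close> or \<open>U\<^sub>i\<^sup>+\<close>) and \<open>Ui a t\<close> the interior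
  state (\<open>U\<^sub>0(0\<^sup>-, t)\<close> or \<open>U\<^sub>i(0\<^sup>+, t)\<close>) of link \<open>a\<close>.
\<close>

definition diverge_solution ::
  "(nat \<Rightarrow> real) \<Rightarrow> (nat \<Rightarrow> state) \<Rightarrow> (nat \<Rightarrow> state) \<Rightarrow> (nat \<Rightarrow> real \<Rightarrow> state) \<Rightarrow> bool" where
  "diverge_solution C U Us Ui \<longleftrightarrow>
     stationary_upstream (C 0) (U 0) (Us 0) \<and>
     (\<forall>i\<in>{1, 2}. stationary_downstream (C i) (U i) (Us i)) \<and>
     flow_rate (Us 0) = flow_rate (Us 1) + flow_rate (Us 2) \<and>
     (\<forall>t>0.
        interior_upstream (C 0) (Us 0) (Ui 0 t) \<and>
        (\<forall>i\<in>{1, 2}. interior_downstream (C i) (Us i) (Ui i t)) \<and>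
        (\<forall>i\<in>{1, 2}. flow_rate (Us i) =
           entropy_flux (dem (Ui 0 t)) (spl (Ui 1 t)) (spl (Ui 2 t)) (spl (Ui i t))))"

text \<open>
  On two borderlines the conditions collected in \<^const>\<open>diverge_solution\<close> leave more freedom in the
  interior states than the usual enumeration of the solutions shows; the stationary states are not
  affected. The next two predicates describe the missing interior states.

  If \<open>S\<^sub>1 + S\<^sub>2 = D\<^sub>0\<close>, the upstream interior state can also be \<open>(C\<^sub>0, D\<^sub>0)\<close>, because the admissible
  condition \<open>S\<^sub>0(0\<^sup>-, t) \<ge> D\<^sub>0\<^sup>-\<close> is not strict; and if it is \<open>(D\<^sub>0, C\<^sub>0)\<close>, the two downstream interior
  supplies can be scaled up by a common factor, because the entropy fluxes only depend on their
  ratio. (If \<open>D\<^sub>0 = 0\<close>, the proportionality holds for all supplies: no flow enters the junction.)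
\<close>

definition extra_interior_balanced ::
  "(nat \<Rightarrow> real) \<Rightarrow> real \<Rightarrow> (nat \<Rightarrow> real) \<Rightarrow> (nat \<Rightarrow> state) \<Rightarrow> bool" where
  "extra_interior_balanced C D0 S W \<longleftrightarrow>
     W 0 = (C 0, D0) \<and> (\<forall>i\<in>{1, 2}. W i = (C i, S i)) \<or>
     W 0 = (D0, C 0) \<and>
       (\<forall>i\<in>{1, 2}. traffic_state (C i) (W i) \<and> S i \<le> dem (W i) \<and> S i \<le> spl (W i)) \<and>
       spl (W 1) * S 2 = spl (W 2) * S 1"

text \<open>
  If \<open>S\<^sub>i = C\<^sub>i D\<^sub>0 / (C\<^sub>1 + C\<^sub>2)\<close>, the interior supply \<open>C\<^sub>j S\<^sub>i / (D\<^sub>0 - S\<^sub>i)\<close> equals \<open>C\<^sub>i\<close>, so that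
  the interior demand on link \<open>i\<close> is not forced to be \<open>C\<^sub>i\<close>. If moreover \<open>D\<^sub>0 = 0\<close>, that quotient is
  the undefined \<open>0 / 0\<close> and the interior state on link \<open>i\<close> is arbitrary.
\<close>

definition extra_interior_fair_share ::
  "(nat \<Rightarrow> real) \<Rightarrow> real \<Rightarrow> (nat \<Rightarrow> real) \<Rightarrow> nat \<Rightarrow> state \<Rightarrow> bool" where
  "extra_interior_fair_share C D0 S i Wi \<longleftrightarrow>
     S i = C i / (C 1 + C 2) * D0 \<and> traffic_state (C i) Wi \<and> S i \<le> dem Wi \<and>
     (D0 = 0 \<or> spl Wi = C i)"

end

theory Submission
  imports Defs
begin

text \<open>
  For each link the admissible conditions leave two alternatives: either the upstream link
  sends its whole demand \<open>D\<^sub>0\<close> (a downstream link absorbs its whole supply \<open>S\<^sub>i\<close>) and the interior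
  state is only bounded from one side; or the flow stays strictly below that value, and then the stationary and the interior state
  are the same state, determined by the flow \<open>q\<close>: \<open>(C\<^sub>0, q)\<close> upstream, \<open>(q, C\<^sub>i)\<close> downstream. The
  entropy condition passes \<open>min (dem W\<^sub>0) (spl W\<^sub>1 + spl W\<^sub>2)\<close> in total, split in proportion to the
  interior supplies \<open>spl W\<^sub>i\<close>.

  Two observations decide which alternatives can occur together. If the upstream link is congested,
  its interior demand is \<open>C\<^sub>0\<close>, so only the interior supplies can limit the flow. A restricted
  downstream link shows the full interior supply \<open>C\<^sub>i\<close> and would be filled, so both downstream links
  absorb their whole supply (\<open>upstream_congested\<close>). Conversely, if link \<open>i\<close> is restricted, then the
  upstream link sends \<open>D\<^sub>0\<close>, its interior demand is exactly \<open>D\<^sub>0\<close>, and link \<open>i\<close>, competing with its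
  largest possible interior supply, receives at least the fair share \<open>C\<^sub>i D\<^sub>0 / (C\<^sub>1 + C\<^sub>2)\<close>
  (\<open>downstream_restricted\<close>).

  Comparing \<open>D\<^sub>0\<close> with \<open>S\<^sub>1 + S\<^sub>2\<close>, and \<open>S\<^sub>i\<close> with the fair share of link \<open>i\<close>, therefore fixes all
  flows, hence the stationary states. For the interior states it remains to solve the proportionality
  of the fluxes for \<open>spl W\<^sub>1\<close> and \<open>spl W\<^sub>2\<close>. If \<open>S\<^sub>1 + S\<^sub>2 = D\<^sub>0\<close>, either the interior demand or the
  interior supplies can be the bottleneck, and the other side is only bounded from below
  (\<^const>\<open>extra_interior_balanced\<close>). If \<open>S\<^sub>i\<close> equals the fair share, then \<open>spl W\<^sub>i = C\<^sub>i\<close> (or nothing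
  flows), and \<open>dem W\<^sub>i\<close> is only bounded from below (\<^const>\<open>extra_interior_fair_share\<close>).
\<close>

section \<open>Admissible states of a single link\<close>

text \<open>
  \<open>A\<close> is the stationary and \<open>W\<close> the interior state. The flow \<open>q\<close> names the alternative in which the
  link is not used to its initial demand (or supply).
\<close>

definition upstream_admissible :: "real \<Rightarrow> real \<Rightarrow> state \<Rightarrow> state \<Rightarrow> bool" where
  "upstream_admissible C D A W \<longleftrightarrow>
     A = (D, C) \<and> traffic_state C W \<and> D \<le> spl W \<or>
     (\<exists>q\<ge>0. q < D \<and> A = (C, q) \<and> W = (C, q))"

definition downstream_admissible :: "real \<Rightarrow> real \<Rightarrow> state \<Rightarrow> state \<Rightarrow> bool" where
  "downstream_admissible C S A W \<longleftrightarrow>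
     A = (C, S) \<and> traffic_state C W \<and> S \<le> dem W \<or>
     (\<exists>q\<ge>0. q < S \<and> A = (q, C) \<and> W = (q, C))"

lemma upstream_admissible_iff:
  assumes "0 \<le> dem U" "dem U \<le> C"
  shows "stationary_upstream C U A \<and> interior_upstream C A W \<longleftrightarrow>
    upstream_admissible C (dem U) A W"
proof -
  have free: "traffic_state C (dem U, C)" "\<not> SOC C (dem U, C)" "UC C (dem U, C)"
    using assms by (simp_all add: traffic_state_def SOC_def UC_def)
  have congested: "traffic_state C (C, q) \<longleftrightarrow> 0 \<le> q" "SOC C (C, q)" "\<not> UC C (C, q)"
    if "q < dem U" for q
    using assms that by (auto simp: traffic_state_def SOC_def UC_def)
  show ?thesis
    unfolding stationary_upstream_def interior_upstream_def upstream_admissible_def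
    using free congested by fastforce
qed

lemma downstream_admissible_iff:
  assumes "0 \<le> spl U" "spl U \<le> C"
  shows "stationary_downstream C U A \<and> interior_downstream C A W \<longleftrightarrow>
    downstream_admissible C (spl U) A W"
proof -
  have full: "traffic_state C (C, spl U)" "\<not> SUC C (C, spl U)" "OC C (C, spl U)"
    using assms by (simp_all add: traffic_state_def SUC_def OC_def)
  have restricted: "traffic_state C (q, C) \<longleftrightarrow> 0 \<le> q" "SUC C (q, C)" "\<not> OC C (q, C)"
    if "q < spl U" for q
    using assms that by (auto simp: traffic_state_def SUC_def OC_def)
  show ?thesis
    unfolding stationary_downstream_def interior_downstream_def downstream_admissible_def
    using full restricted by fastforce
qed

lemma upstream_admissible_bounds:
  assumes "upstream_admissible C D A W" "0 \<le> D" "D \<le> C"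
  shows "traffic_state C W" "flow_rate A \<le> D"
  using assms by (auto simp: upstream_admissible_def traffic_state_def flow_rate_def)

lemma downstream_admissible_bounds:
  assumes "downstream_admissible C S A W" "0 \<le> S" "S \<le> C"
  shows "traffic_state C W" "0 \<le> flow_rate A" "flow_rate A \<le> S"
  using assms by (auto simp: downstream_admissible_def traffic_state_def flow_rate_def)

lemma traffic_state_demand_eqI:
  assumes "traffic_state C W" "dem W \<le> spl W"
  shows "W = (dem W, C)"
  using assms by (cases W) (auto simp: traffic_state_def)

lemma traffic_state_supply_eqI:
  assumes "traffic_state C W" "spl W \<le> dem W"
  shows "W = (C, spl W)"
  using assms by (cases W) (auto simp: traffic_state_def)

text \<open>
  On the increasing branch of the flow-density relation the supply is the capacity, on the decreasing
  branch the demand is; monotonicity on each branch bounds the other component.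
\<close>

lemma traffic_state_of_density:
  assumes "unimodal_link V \<rho>c" "0 \<le> \<rho>"
  shows "traffic_state (capacity V \<rho>c) (demand_of V \<rho>c \<rho>, supply_of V \<rho>c \<rho>)"
proof -
  have nonneg: "0 \<le> flow_density V r" if "0 \<le> r" for r
    using assms(1) that by (simp add: unimodal_link_def flow_density_def)
  have incr: "flow_density V x \<le> flow_density V y" if "0 \<le> x" "x \<le> y" "y \<le> \<rho>c" for x y
    using assms(1) that by (auto simp: unimodal_link_def monotone_on_def)
  have decr: "flow_density V y \<le> flow_density V x" if "\<rho>c \<le> x" "x \<le> y" for x y
    using assms(1) that by (auto simp: unimodal_link_def monotone_on_def)
  have "0 \<le> \<rho>c" using assms(1) by (simp add: unimodal_link_def)
  show ?thesis
  proof (cases "\<rho> \<le> \<rho>c")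
    case True
    then show ?thesis
      using assms(2) nonneg[of \<rho>] nonneg[of \<rho>c] incr[of \<rho> \<rho>c] \<open>0 \<le> \<rho>c\<close>
      by (simp add: traffic_state_def demand_of_def supply_of_def capacity_def)
  next
    case False
    then show ?thesis
      using assms(2) nonneg[of \<rho>] nonneg[of \<rho>c] decr[of \<rho>c \<rho>] \<open>0 \<le> \<rho>c\<close>
      by (simp add: traffic_state_def demand_of_def supply_of_def capacity_def)
  qed
qed

section \<open>The flow through the junction\<close>

text \<open>
  The interior supplies are met in full, or the interior demand is split in proportion to them. The
  convention for two vanishing supplies is an instance of the first regime.
\<close>

lemma entropy_flux_regimes:
  assumes "0 \<le> d" "0 \<le> s1" "0 \<le> s2" "s = s1 \<or> s = s2"
  shows "entropy_flux d s1 s2 s = (if s1 + s2 \<le> d then s else d * s / (s1 + s2))"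
proof (cases "s1 + s2 = 0")
  case True
  with assms show ?thesis by (auto simp: entropy_flux_def)
next
  case False
  with assms have "0 < s1 + s2" by linarith
  with assms(1) show ?thesis
    by (auto simp: entropy_flux_def min_def divide_simps)
qed

text \<open>
  The assumptions on \<open>C1\<close>, \<open>S1\<close> and \<open>C2\<close>, \<open>S2\<close> are invariant under exchanging the downstream links, so
  that every result about the first one can be interpreted for the second.
\<close>

locale diverge_junction =
  fixes C0 C1 C2 D0 S1 S2 :: real
  assumes C: "0 < C1" "0 < C2"
    and D0: "0 \<le> D0" "D0 \<le> C0"
    and S: "0 \<le> S1" "S1 \<le> C1" "0 \<le> S2" "S2 \<le> C2"
begin

definition solves :: "state \<Rightarrow> state \<Rightarrow> state \<Rightarrow> state \<Rightarrow> state \<Rightarrow> state \<Rightarrow> bool" where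
  "solves A0 A1 A2 W0 W1 W2 \<longleftrightarrow>
     upstream_admissible C0 D0 A0 W0 \<and>
     downstream_admissible C1 S1 A1 W1 \<and> downstream_admissible C2 S2 A2 W2 \<and>
     flow_rate A0 = flow_rate A1 + flow_rate A2 \<and>
     flow_rate A1 = entropy_flux (dem W0) (spl W1) (spl W2) (spl W1) \<and>
     flow_rate A2 = entropy_flux (dem W0) (spl W1) (spl W2) (spl W2)"

lemma swapped: "diverge_junction C0 C2 C1 D0 S2 S1"
  using C D0 S by unfold_locales

lemma solves_swapped:
  "diverge_junction.solves C0 C2 C1 D0 S2 S1 A0 A2 A1 W0 W2 W1 = solves A0 A1 A2 W0 W1 W2"
proof -
  have "entropy_flux d s2 s1 s = entropy_flux d s1 s2 s" for d s1 s2 s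
    by (simp add: entropy_flux_def add.commute conj_commute)
  then show ?thesis
    unfolding solves_def diverge_junction.solves_def[OF swapped] by (auto simp: add.commute)
qed

lemma solves_bounds:
  assumes "solves A0 A1 A2 W0 W1 W2"
  shows "traffic_state C0 W0" "traffic_state C1 W1" "traffic_state C2 W2"
    "flow_rate A0 = flow_rate A1 + flow_rate A2"
    "0 \<le> flow_rate A1" "0 \<le> flow_rate A2"
    "flow_rate A0 \<le> D0" "flow_rate A1 \<le> S1" "flow_rate A2 \<le> S2"
proof -
  have adm: "upstream_admissible C0 D0 A0 W0" "downstream_admissible C1 S1 A1 W1"
    "downstream_admissible C2 S2 A2 W2"
    using assms by (auto simp: solves_def)
  show "traffic_state C0 W0" "flow_rate A0 \<le> D0"
    using upstream_admissible_bounds[OF adm(1) D0] by auto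
  show "traffic_state C1 W1" "0 \<le> flow_rate A1" "flow_rate A1 \<le> S1"
    using downstream_admissible_bounds[OF adm(2) S(1,2)] by auto
  show "traffic_state C2 W2" "0 \<le> flow_rate A2" "flow_rate A2 \<le> S2"
    using downstream_admissible_bounds[OF adm(3) S(3,4)] by auto
  show "flow_rate A0 = flow_rate A1 + flow_rate A2"
    using assms by (simp add: solves_def)
qed

lemma solves_regimes:
  assumes "solves A0 A1 A2 W0 W1 W2"
  obtains (supply_bound) "spl W1 + spl W2 \<le> dem W0" "flow_rate A1 = spl W1" "flow_rate A2 = spl W2"
  | (demand_bound) "dem W0 < spl W1 + spl W2" "flow_rate A0 = dem W0"
      "flow_rate A1 * (spl W1 + spl W2) = dem W0 * spl W1"
      "flow_rate A2 * (spl W1 + spl W2) = dem W0 * spl W2"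
proof -
  have nn: "0 \<le> dem W0" "0 \<le> spl W1" "0 \<le> spl W2"
    using solves_bounds(1-3)[OF assms] by (auto simp: traffic_state_def)
  note flux = entropy_flux_regimes[OF nn]
  show thesis
  proof (cases "spl W1 + spl W2 \<le> dem W0")
    case True
    then show thesis
      using assms supply_bound by (simp add: solves_def flux)
  next
    case False
    then have pos: "0 < spl W1 + spl W2" using nn by linarith
    have q: "flow_rate A1 = dem W0 * spl W1 / (spl W1 + spl W2)"
      "flow_rate A2 = dem W0 * spl W2 / (spl W1 + spl W2)"
      using assms False by (simp_all add: solves_def flux)
    have "flow_rate A0 = dem W0 * (spl W1 + spl W2) / (spl W1 + spl W2)"
      unfolding solves_bounds(4)[OF assms] q by (simp add: add_divide_distrib distrib_left)
    with pos have "flow_rate A0 = dem W0" by simp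
    with False q pos show thesis by (intro demand_bound) (auto simp: field_simps)
  qed
qed

lemma upstream_cases:
  assumes "solves A0 A1 A2 W0 W1 W2"
  obtains (free) "A0 = (D0, C0)" "flow_rate A0 = D0" "D0 \<le> spl W0"
  | (congested) q where "q < D0" "flow_rate A0 = q" "A0 = (C0, q)" "W0 = (C0, q)"
proof -
  from assms have "upstream_admissible C0 D0 A0 W0" by (simp add: solves_def)
  then consider "A0 = (D0, C0)" "D0 \<le> spl W0" | q where "q < D0" "A0 = (C0, q)" "W0 = (C0, q)"
    unfolding upstream_admissible_def by blast
  then show thesis
  proof cases
    case 1
    then have "flow_rate A0 = D0" using D0 by (simp add: flow_rate_def)
    with 1 show thesis using free by blast
  next
    case 2
    then have "flow_rate A0 = q" using D0 by (simp add: flow_rate_def)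
    with 2 show thesis using congested by blast
  qed
qed

lemma downstream_cases:
  assumes "solves A0 A1 A2 W0 W1 W2"
  obtains (full) "A1 = (C1, S1)" "flow_rate A1 = S1" "S1 \<le> dem W1"
  | (restricted) q where "q < S1" "flow_rate A1 = q" "A1 = (q, C1)" "W1 = (q, C1)"
proof -
  from assms have "downstream_admissible C1 S1 A1 W1" by (simp add: solves_def)
  then consider "A1 = (C1, S1)" "S1 \<le> dem W1" | q where "q < S1" "A1 = (q, C1)" "W1 = (q, C1)"
    unfolding downstream_admissible_def by blast
  then show thesis
  proof cases
    case 1
    then have "flow_rate A1 = S1" using S by (simp add: flow_rate_def)
    with 1 show thesis using full by blast
  next
    case 2
    then have "flow_rate A1 = q" using S by (simp add: flow_rate_def)
    with 2 show thesis using restricted by blast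
  qed
qed

text \<open>
  A congested upstream link offers the interior demand \<open>C0\<close>. If that were the bottleneck, the flow
  would be \<open>C0\<close>, which is at least \<open>D0\<close>; so every downstream link receives its interior supply. For
  a restricted link this is \<open>C1\<close>, contradicting that its flow is below \<open>S1\<close>.
\<close>

lemma upstream_congested:
  assumes sol: "solves A0 A1 A2 W0 W1 W2" and "flow_rate A0 < D0"
  shows "flow_rate A1 = S1"
proof -
  from sol have "W0 = (C0, flow_rate A0)"
    by (rule upstream_cases) (use assms(2) in auto)
  then have W0: "dem W0 = C0" by (metis fst_conv)
  show ?thesis
    using sol
  proof (cases rule: solves_regimes)
    case supply_bound
    from sol show ?thesis
      by (rule downstream_cases) (use supply_bound(2) S in auto)
  next
    case demand_bound
    then show ?thesis using W0 D0 assms(2) by simp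
  qed
qed

text \<open>
  A restricted downstream link has interior supply \<open>C1\<close> but receives less, so the interior demand is
  the bottleneck and equals the total flow \<open>D0\<close>. Its share \<open>C1 / (C1 + spl W2)\<close> of that flow is
  smallest when the other interior supply is as large as possible, namely \<open>C2\<close>.
\<close>

lemma downstream_restricted:
  assumes sol: "solves A0 A1 A2 W0 W1 W2" and "flow_rate A1 < S1"
  shows "A0 = (D0, C0)" "W0 = (D0, C0)" "A1 = (flow_rate A1, C1)" "W1 = (flow_rate A1, C1)"
    "flow_rate A2 = D0 - flow_rate A1"
    "flow_rate A1 * (C1 + spl W2) = D0 * C1"
    "C1 / (C1 + C2) * D0 \<le> flow_rate A1"
proof -
  from sol have A1: "A1 = (flow_rate A1, C1) \<and> W1 = (flow_rate A1, C1)"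
    by (rule downstream_cases) (use assms(2) in auto)
  then show "A1 = (flow_rate A1, C1)" "W1 = (flow_rate A1, C1)" by auto
  from A1 have s1: "spl W1 = C1" by (metis snd_conv)
  from sol have A0: "A0 = (D0, C0) \<and> flow_rate A0 = D0 \<and> D0 \<le> spl W0"
    by (rule upstream_cases) (use assms(2) upstream_congested[OF sol] in auto)
  then show "A0 = (D0, C0)" by simp
  show q2: "flow_rate A2 = D0 - flow_rate A1" using solves_bounds(4)[OF sol] A0 by linarith
  have d: "dem W0 = D0" and q: "flow_rate A1 * (C1 + spl W2) = D0 * C1"
  proof -
    have "dem W0 = D0 \<and> flow_rate A1 * (C1 + spl W2) = D0 * C1"
      using sol
    proof (cases rule: solves_regimes)
      case supply_bound
      then show ?thesis using s1 assms(2) S by linarith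
    next
      case demand_bound
      then show ?thesis using s1 A0 by metis
    qed
    then show "dem W0 = D0" "flow_rate A1 * (C1 + spl W2) = D0 * C1" by auto
  qed
  show "flow_rate A1 * (C1 + spl W2) = D0 * C1" by (fact q)
  show "W0 = (D0, C0)"
    using traffic_state_demand_eqI[OF solves_bounds(1)[OF sol]] A0 d by simp
  have "spl W2 \<le> C2" using solves_bounds(3)[OF sol] by (simp add: traffic_state_def)
  then have "D0 * C1 \<le> flow_rate A1 * (C1 + C2)"
    unfolding q[symmetric] using solves_bounds(5)[OF sol] by (intro mult_left_mono) auto
  then show "C1 / (C1 + C2) * D0 \<le> flow_rate A1"
    using C by (simp add: field_simps)
qed

lemma supply_limited_interior:
  assumes sol: "solves A0 A1 A2 W0 W1 W2"
    and q: "flow_rate A1 = S1" and "spl W1 = S1"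
  shows "W1 = (C1, S1)"
proof -
  from sol have "S1 \<le> dem W1"
    by (rule downstream_cases) (use q in auto)
  then show ?thesis
    using traffic_state_supply_eqI[OF solves_bounds(2)[OF sol]] assms(3) by simp
qed

lemma full_stationary:
  assumes sol: "solves A0 A1 A2 W0 W1 W2" and "flow_rate A1 = S1"
  shows "A1 = (C1, S1)"
  using sol by (rule downstream_cases) (use assms(2) in auto)

section \<open>The solutions in each range of supplies and demand\<close>

text \<open>
  The downstream links cannot take \<open>D0\<close>, so the upstream link is congested.
\<close>

lemma supply_below_demand:
  assumes lt: "S1 + S2 < D0"
  shows "solves A0 A1 A2 W0 W1 W2 \<longleftrightarrow>
    A0 = (C0, S1 + S2) \<and> A1 = (C1, S1) \<and> A2 = (C2, S2) \<and> W0 = A0 \<and> W1 = A1 \<and> W2 = A2"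
    (is "?sol \<longleftrightarrow> ?states")
proof
  assume sol: ?sol
  interpret swap: diverge_junction C0 C2 C1 D0 S2 S1 by (fact swapped)
  note sol' = sol[folded solves_swapped]
  have less: "flow_rate A0 < D0" using solves_bounds(4,8,9)[OF sol] lt by linarith
  have q: "flow_rate A1 = S1" "flow_rate A2 = S2"
    using upstream_congested[OF sol less] swap.upstream_congested[OF sol' less] by auto
  then have q0: "flow_rate A0 = S1 + S2" using solves_bounds(4)[OF sol] by simp
  from sol have W0: "A0 = (C0, flow_rate A0) \<and> W0 = (C0, flow_rate A0)"
    by (rule upstream_cases) (use less in auto)
  then have d: "dem W0 = C0" by (metis fst_conv)
  have s: "spl W1 = S1 \<and> spl W2 = S2"
    using sol by (cases rule: solves_regimes) (use q d D0 less in auto)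
  show ?states
    using W0 q0 full_stationary[OF sol q(1)] swap.full_stationary[OF sol' q(2)]
      supply_limited_interior[OF sol q(1)] swap.supply_limited_interior[OF sol' q(2)] s
    by simp
next
  assume ?states
  with lt C D0 S show ?sol
    by (auto simp: solves_def upstream_admissible_def downstream_admissible_def traffic_state_def
        flow_rate_def entropy_flux_regimes)
qed

text \<open>
  Both alternatives of the upstream link force \<open>S1\<close> and \<open>S2\<close> as flows. In the regime where the
  interior supplies are met they are then \<open>S1\<close> and \<open>S2\<close>, and the interior demand is merely
  bounded below by \<open>D0\<close>; in the regime where the interior demand is split, it is \<open>D0\<close>, and the
  interior supplies are merely at least \<open>S1\<close> and \<open>S2\<close> and in the ratio of these.
\<close>

lemma supply_equals_demand:
  assumes eq: "S1 + S2 = D0"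
  shows "solves A0 A1 A2 W0 W1 W2 \<longleftrightarrow>
    A0 = (D0, C0) \<and> A1 = (C1, S1) \<and> A2 = (C2, S2) \<and>
    ((W0 = (D0, C0) \<or> D0 < C0 \<and> traffic_state C0 W0 \<and> D0 \<le> dem W0 \<and> D0 < spl W0) \<and>
       W1 = A1 \<and> W2 = A2 \<or>
     W0 = (C0, D0) \<and> W1 = (C1, S1) \<and> W2 = (C2, S2) \<or>
     W0 = (D0, C0) \<and> traffic_state C1 W1 \<and> S1 \<le> dem W1 \<and> S1 \<le> spl W1 \<and>
       traffic_state C2 W2 \<and> S2 \<le> dem W2 \<and> S2 \<le> spl W2 \<and> spl W1 * S2 = spl W2 * S1)"
    (is "?sol \<longleftrightarrow> ?states")
proof
  assume sol: ?sol
  interpret swap: diverge_junction C0 C2 C1 D0 S2 S1 by (fact swapped)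
  note sol' = sol[folded solves_swapped]
  have q: "flow_rate A1 = S1" "flow_rate A2 = S2"
  proof -
    have "flow_rate A1 = S1 \<and> flow_rate A2 = S2"
    proof (cases "flow_rate A0 < D0")
      case True
      then show ?thesis
        using upstream_congested[OF sol] swap.upstream_congested[OF sol'] by simp
    next
      case False
      then show ?thesis using solves_bounds(4,7,8,9)[OF sol] eq by linarith
    qed
    then show "flow_rate A1 = S1" "flow_rate A2 = S2" by auto
  qed
  from q have q0: "flow_rate A0 = D0" using solves_bounds(4)[OF sol] eq by simp
  from sol have A0: "A0 = (D0, C0) \<and> D0 \<le> spl W0"
    by (rule upstream_cases) (use q0 in auto)
  from sol have d1: "S1 \<le> dem W1" by (rule downstream_cases) (use q in auto)
  from sol' have d2: "S2 \<le> dem W2" by (rule swap.downstream_cases) (use q in auto)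
  note A = full_stationary[OF sol q(1)] swap.full_stationary[OF sol' q(2)]
  show ?states
    using sol
  proof (cases rule: solves_regimes)
    case supply_bound
    then have W: "W1 = (C1, S1)" "W2 = (C2, S2)"
      using supply_limited_interior[OF sol q(1)] swap.supply_limited_interior[OF sol' q(2)] q
      by auto
    have d: "D0 \<le> dem W0" using supply_bound q eq by simp
    have "W0 = (D0, C0) \<or> D0 < C0 \<and> traffic_state C0 W0 \<and> D0 \<le> dem W0 \<and> D0 < spl W0 \<or>
      W0 = (C0, D0)"
      using solves_bounds(1)[OF sol] A0 d D0 by (cases W0) (auto simp: traffic_state_def)
    with W A A0 show ?thesis by auto
  next
    case demand_bound
    have d: "dem W0 = D0" using demand_bound q0 by simp
    then have W0: "W0 = (D0, C0)"
      using traffic_state_demand_eqI[OF solves_bounds(1)[OF sol]] A0 by simp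
    let ?s = "spl W1 + spl W2"
    have ratio: "S1 * ?s = D0 * spl W1" "S2 * ?s = D0 * spl W2"
      using demand_bound q d by auto
    have nn: "0 \<le> spl W1" "0 \<le> spl W2"
      using solves_bounds(2,3)[OF sol] by (auto simp: traffic_state_def)
    have lt: "D0 < ?s" using demand_bound d by simp
    have "D0 * spl W1 \<le> ?s * spl W1" "D0 * spl W2 \<le> ?s * spl W2"
      using lt nn by (auto intro: mult_right_mono)
    then have "S1 * ?s \<le> spl W1 * ?s" "S2 * ?s \<le> spl W2 * ?s"
      unfolding ratio by (simp_all only: mult.commute)
    with lt D0 have ge: "S1 \<le> spl W1" "S2 \<le> spl W2" by auto
    have "spl W1 * S2 = spl W2 * S1"
      using ratio(1) unfolding eq[symmetric] by (simp add: algebra_simps)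
    with ge W0 A A0 d1 d2 solves_bounds(2,3)[OF sol] show ?thesis by auto
  qed
next
  assume states: ?states
  show ?sol
  proof (cases "W1 = (C1, S1) \<and> W2 = (C2, S2)")
    case True
    with states eq C D0 S show ?thesis
      by (auto simp: solves_def upstream_admissible_def downstream_admissible_def
          traffic_state_def flow_rate_def entropy_flux_regimes)
  next
    case False
    with states have W0: "W0 = (D0, C0)" and A: "A0 = (D0, C0)" "A1 = (C1, S1)" "A2 = (C2, S2)"
      and t: "traffic_state C1 W1" "traffic_state C2 W2"
      and dS: "S1 \<le> dem W1" "S2 \<le> dem W2"
      and sS: "S1 \<le> spl W1" "S2 \<le> spl W2"
      and ratio: "spl W1 * S2 = spl W2 * S1" by auto
    let ?s = "spl W1 + spl W2"
    have adm: "upstream_admissible C0 D0 A0 W0" "downstream_admissible C1 S1 A1 W1"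
      "downstream_admissible C2 S2 A2 W2"
      using A W0 t dS D0
      by (auto simp: upstream_admissible_def downstream_admissible_def traffic_state_def)
    have mul: "S1 * ?s = D0 * spl W1" "S2 * ?s = D0 * spl W2"
      using ratio unfolding eq[symmetric] by (simp_all add: algebra_simps)
    have flux: "entropy_flux D0 (spl W1) (spl W2) (spl W1) = S1"
      "entropy_flux D0 (spl W1) (spl W2) (spl W2) = S2"
      using mul eq sS S D0 by (auto simp: entropy_flux_regimes field_simps)
    show ?thesis
      using adm flux A W0 eq S D0 by (simp add: solves_def flow_rate_def)
  qed
qed

text \<open>
  If one downstream link absorbed its whole supply, the other one would be left with less than its
  fair share, although it receives at least that share if it is restricted and even more if it
  absorbs its whole supply. So both are restricted, and as the fair shares add up to \<open>D0\<close>, both lower bounds are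
  attained.
\<close>

lemma demand_below_fair_shares:
  assumes S1: "C1 / (C1 + C2) * D0 < S1" and S2: "C2 / (C1 + C2) * D0 < S2"
  shows "solves A0 A1 A2 W0 W1 W2 \<longleftrightarrow>
    A0 = (D0, C0) \<and> A1 = (C1 / (C1 + C2) * D0, C1) \<and> A2 = (C2 / (C1 + C2) * D0, C2) \<and>
    W0 = A0 \<and> W1 = A1 \<and> W2 = A2"
    (is "?sol \<longleftrightarrow> ?states")
proof -
  have shares: "C1 / (C1 + C2) * D0 + C2 / (C1 + C2) * D0 = D0"
    using C by (simp add: add_divide_distrib[symmetric] distrib_right[symmetric])
  show ?thesis
  proof
    assume sol: ?sol
    interpret swap: diverge_junction C0 C2 C1 D0 S2 S1 by (fact swapped)
    note sol' = sol[folded solves_swapped]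
    note r1 = downstream_restricted[OF sol] and r2 = swap.downstream_restricted[OF sol']
    have q: "flow_rate A1 < S1 \<and> flow_rate A2 < S2"
      using r1(7) r2(7) solves_bounds(4,7-9)[OF sol] shares S1 S2
      by (smt (verit) add.commute)
    then have "flow_rate A1 = C1 / (C1 + C2) * D0" "flow_rate A2 = C2 / (C1 + C2) * D0"
      using r1(5,7) r2(7) shares by (smt (verit) add.commute)+
    with q r1(1-4) r2(3,4) show ?states by simp
  next
    assume states: ?states
    have "C1 / (C1 + C2) * D0 + C2 / (C1 + C2) * D0 < C1 + C2" using S1 S2 S by linarith
    with shares have lt: "D0 < C1 + C2" by simp
    have nn: "0 \<le> C1 / (C1 + C2) * D0" "0 \<le> C2 / (C1 + C2) * D0" using C D0 by auto
    have adm: "upstream_admissible C0 D0 A0 W0" "downstream_admissible C1 S1 A1 W1"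
      "downstream_admissible C2 S2 A2 W2"
      using states nn S1 S2 D0
      by (auto simp: upstream_admissible_def downstream_admissible_def traffic_state_def)
    have flows: "flow_rate A0 = D0" "flow_rate A1 = C1 / (C1 + C2) * D0"
      "flow_rate A2 = C2 / (C1 + C2) * D0"
      using states S1 S2 S D0 by (auto simp: flow_rate_def)
    show ?sol
      using adm flows shares states lt C D0
      by (simp add: solves_def entropy_flux_regimes mult.commute)
  qed
qed

text \<open>
  Link 1 cannot be restricted, since it would receive its fair share or more; link 2 then has to be,
  since \<open>S1 + S2\<close> exceeds \<open>D0\<close>. The second interior supply is thus \<open>C2\<close>, and the ratio of the flows
  \<open>S1\<close> and \<open>D0 - S1\<close> determines the first one, unless both flows vanish.
\<close>

lemma first_supply_below_fair_share:
  assumes gt: "D0 < S1 + S2" and S1: "S1 \<le> C1 / (C1 + C2) * D0"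
  shows "solves A0 A1 A2 W0 W1 W2 \<longleftrightarrow>
    A0 = (D0, C0) \<and> A1 = (C1, S1) \<and> A2 = (D0 - S1, C2) \<and> W0 = A0 \<and> W2 = A2 \<and>
    (W1 = (C1, C2 / (D0 - S1) * S1) \<or>
     S1 = C1 / (C1 + C2) * D0 \<and> traffic_state C1 W1 \<and> S1 \<le> dem W1 \<and> (D0 = 0 \<or> spl W1 = C1))"
    (is "?sol \<longleftrightarrow> ?states")
proof -
  have S1': "S1 * (C1 + C2) \<le> C1 * D0" using S1 C by (simp add: field_simps)
  \<comment> \<open>The denominator in the interior supply of link 1 vanishes only if there is no demand.\<close>
  have pos: "S1 < D0" if "D0 \<noteq> 0"
  proof -
    have "C1 * D0 < D0 * (C1 + C2)" using that D0 C by (simp add: algebra_simps)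
    with S1' have "S1 * (C1 + C2) < D0 * (C1 + C2)" by linarith
    with C show ?thesis by (simp add: mult_less_cancel_right)
  qed
  have zero: "S1 = 0" if "D0 = 0" using S1 S that by simp
  show ?thesis
  proof
    assume sol: ?sol
    interpret swap: diverge_junction C0 C2 C1 D0 S2 S1 by (fact swapped)
    note sol' = sol[folded solves_swapped]
    have q1: "flow_rate A1 = S1"
      using downstream_restricted(7)[OF sol] S1 solves_bounds(8)[OF sol] by linarith
    have "flow_rate A2 < S2" using solves_bounds(4,7)[OF sol] q1 gt by linarith
    note r = swap.downstream_restricted[OF sol' this]
    have q2: "flow_rate A2 = D0 - S1" using r(5) q1 by simp
    from sol have d1: "S1 \<le> dem W1" by (rule downstream_cases) (use q1 in auto)
    have t1: "traffic_state C1 W1" by (fact solves_bounds(2)[OF sol])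
    have ratio: "(D0 - S1) * spl W1 = S1 * C2"
      using r(6) q2 by (simp add: algebra_simps)
    have "W1 = (C1, C2 / (D0 - S1) * S1) \<or>
      S1 = C1 / (C1 + C2) * D0 \<and> traffic_state C1 W1 \<and> S1 \<le> dem W1 \<and> (D0 = 0 \<or> spl W1 = C1)"
    proof (cases "D0 = 0")
      case True
      with zero t1 d1 show ?thesis by simp
    next
      case False
      with ratio pos have s1: "spl W1 = C2 / (D0 - S1) * S1" by (simp add: field_simps)
      show ?thesis
      proof (cases "dem W1 = C1")
        case True
        with s1 show ?thesis by (cases W1) simp
      next
        case False
        with t1 have full: "spl W1 = C1" by (auto simp: traffic_state_def max_def split: if_splits)
        with ratio have "S1 = C1 / (C1 + C2) * D0" using C by (simp add: field_simps)
        with t1 d1 full show ?thesis by simp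
      qed
    qed
    with r(1-4) q2 full_stationary[OF sol q1] show ?states by simp
  next
    assume states: ?states
    have nn: "S1 \<le> D0" using pos zero D0 by fastforce
    have s2: "D0 - S1 < S2" "D0 - S1 < C2" using gt S by linarith+
    have A: "A0 = (D0, C0)" "A1 = (C1, S1)" "A2 = (D0 - S1, C2)" "W0 = (D0, C0)"
      "W2 = (D0 - S1, C2)" using states by auto
    \<comment> \<open>Both descriptions of \<open>W1\<close> put the interior supplies in the ratio of the flows.\<close>
    have W1: "traffic_state C1 W1 \<and> S1 \<le> dem W1 \<and> (D0 - S1) * spl W1 = S1 * C2"
    proof (cases "D0 = 0")
      case True
      with zero states C show ?thesis by (auto simp: traffic_state_def)
    next
      case False
      with pos have p: "0 < D0 - S1" by simp
      have "C2 / (D0 - S1) * S1 \<le> C1" using S1' p by (simp add: field_simps)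
      moreover have "0 \<le> C2 / (D0 - S1) * S1" using p C S by simp
      moreover have "(D0 - S1) * C1 = S1 * C2" if "S1 = C1 / (C1 + C2) * D0"
        using that C by (simp add: field_simps)
      ultimately show ?thesis using states False p S C by (auto simp: traffic_state_def)
    qed
    then have s1: "0 \<le> spl W1" by (simp add: traffic_state_def)
    have ratio: "D0 * spl W1 = S1 * (spl W1 + C2)" using W1 by (simp add: algebra_simps)
    \<comment> \<open>The interior demand is the bottleneck: if \<open>spl W1\<close> is below \<open>S1\<close>, the ratio of the supplies
    contradicts \<open>D0 - S1 < C2\<close>.\<close>
    have le: "D0 < spl W1 + C2"
    proof (cases "S1 \<le> spl W1")
      case True
      with s2 show ?thesis by linarith
    next
      case False
      then have "(D0 - S1) * spl W1 \<le> C2 * spl W1" "C2 * spl W1 < C2 * S1"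
        using s2 s1 C by (auto intro: mult_right_mono)
      with W1 show ?thesis by (simp add: mult.commute)
    qed
    have flux: "entropy_flux D0 (spl W1) C2 (spl W1) = S1"
      "entropy_flux D0 (spl W1) C2 C2 = D0 - S1"
      using ratio le s1 C D0 by (auto simp: entropy_flux_regimes field_simps)
    have "upstream_admissible C0 D0 A0 W0" "downstream_admissible C1 S1 A1 W1"
      "downstream_admissible C2 S2 A2 W2"
      using A W1 D0 s2 nn
      by (auto simp: upstream_admissible_def downstream_admissible_def traffic_state_def)
    with flux A D0 S s2 show ?sol by (simp add: solves_def flow_rate_def)
  qed
qed

end

section \<open>The solutions of the Riemann problem\<close>

text \<open>
  The time-independent conditions may be placed under the quantifier over positive times, and the
  downstream links may be listed in either order.
\<close>

lemma diverge_solution_iff_solves: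
  assumes ij: "{i, j} = {1, 2}"
    and J: "diverge_junction (C 0) (C i) (C j) (dem (U 0)) (spl (U i)) (spl (U j))"
  shows "diverge_solution C U Us Ui \<longleftrightarrow>
    (\<forall>t>0. diverge_junction.solves (C 0) (C i) (C j) (dem (U 0)) (spl (U i)) (spl (U j))
       (Us 0) (Us i) (Us j) (Ui 0 t) (Ui i t) (Ui j t))"
proof -
  interpret diverge_junction "C 0" "C i" "C j" "dem (U 0)" "spl (U i)" "spl (U j)" by (fact J)
  have ball: "(\<forall>k\<in>{1, 2}. P k) \<longleftrightarrow> P i \<and> P j" for P :: "nat \<Rightarrow> bool"
    unfolding ij[symmetric] by simp
  have sum: "flow_rate (Us 1) + flow_rate (Us 2) = flow_rate (Us i) + flow_rate (Us j)"
    using ij by (auto simp: doubleton_eq_iff)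
  have flux: "entropy_flux d (spl (Ui 1 t)) (spl (Ui 2 t)) s =
      entropy_flux d (spl (Ui i t)) (spl (Ui j t)) s" for d s t
    using ij by (auto simp: doubleton_eq_iff entropy_flux_def add.commute)
  have t: "\<exists>t::real. t > 0" using zero_less_one by blast
  show ?thesis
    unfolding diverge_solution_def ball sum flux solves_def
      upstream_admissible_iff[OF D0, symmetric]
      downstream_admissible_iff[OF S(1,2), symmetric]
      downstream_admissible_iff[OF S(3,4), symmetric]
    using t by auto
qed

theorem theorem5p1:
  fixes V :: "nat \<Rightarrow> real \<Rightarrow> real" and \<rho>c \<rho> C D S :: "nat \<Rightarrow> real"
    and U Us :: "nat \<Rightarrow> state" and Ui :: "nat \<Rightarrow> real \<Rightarrow> state"
  assumes link: "\<forall>a\<in>{0, 1, 2}. unimodal_link (V a) (\<rho>c a)"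
    and cap: "\<forall>a\<in>{0, 1, 2}. C a = capacity (V a) (\<rho>c a)"
    and cap_pos: "\<forall>a\<in>{0, 1, 2}. C a > 0"
    and density: "\<forall>a\<in>{0, 1, 2}. \<rho> a \<ge> 0"
    and D: "\<forall>a\<in>{0, 1, 2}. D a = demand_of (V a) (\<rho>c a) (\<rho> a)"
    and S: "\<forall>a\<in>{0, 1, 2}. S a = supply_of (V a) (\<rho>c a) (\<rho> a)"
    and U: "\<forall>a\<in>{0, 1, 2}. U a = (D a, S a)"
  shows
    "(S 1 + S 2 < D 0 \<longrightarrow>
        (diverge_solution C U Us Ui \<longleftrightarrow>
           Us 0 = (C 0, S 1 + S 2) \<and> (\<forall>i\<in>{1, 2}. Us i = (C i, S i)) \<and>
           (\<forall>t>0. Ui 0 t = Us 0 \<and> (\<forall>i\<in>{1, 2}. Ui i t = Us i)))) \<and>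
     (S 1 + S 2 = D 0 \<longrightarrow>
        (diverge_solution C U Us Ui \<longleftrightarrow>
           Us 0 = (D 0, C 0) \<and> (\<forall>i\<in>{1, 2}. Us i = (C i, S i)) \<and>
           (\<forall>t>0.
              (Ui 0 t = (D 0, C 0) \<or>
               D 0 < C 0 \<and> traffic_state (C 0) (Ui 0 t) \<and>
                 dem (Ui 0 t) \<ge> D 0 \<and> spl (Ui 0 t) > D 0) \<and>
              (\<forall>i\<in>{1, 2}. Ui i t = Us i) \<or>
              extra_interior_balanced C (D 0) S (\<lambda>a. Ui a t)))) \<and>
     ((\<forall>i\<in>{1, 2}. S i > C i / (C 1 + C 2) * D 0) \<longrightarrow>
        (diverge_solution C U Us Ui \<longleftrightarrow>
           Us 0 = (D 0, C 0) \<and> (\<forall>i\<in>{1, 2}. Us i = (C i / (C 1 + C 2) * D 0, C i)) \<and>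
           (\<forall>t>0. Ui 0 t = Us 0 \<and> (\<forall>i\<in>{1, 2}. Ui i t = Us i)))) \<and>
     (\<forall>i j. {i, j} = {1, 2} \<and> S 1 + S 2 > D 0 \<and> S i \<le> C i / (C 1 + C 2) * D 0 \<longrightarrow>
        (diverge_solution C U Us Ui \<longleftrightarrow>
           Us 0 = (D 0, C 0) \<and> Us i = (C i, S i) \<and> Us j = (D 0 - S i, C j) \<and>
           (\<forall>t>0. Ui 0 t = Us 0 \<and> Ui j t = Us j \<and>
              (Ui i t = (C i, C j / (D 0 - S i) * S i) \<or>
               extra_interior_fair_share C (D 0) S i (Ui i t)))))"
proof -
  have state: "traffic_state (C a) (D a, S a)" if "a \<in> {0, 1, 2}" for a
    using traffic_state_of_density[of "V a" "\<rho>c a" "\<rho> a"] link cap density D S that by auto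
  have init: "dem (U 0) = D 0" "spl (U 1) = S 1" "spl (U 2) = S 2" using U by auto
  have J: "diverge_junction (C 0) (C 1) (C 2) (D 0) (S 1) (S 2)"
    using state[of 0] state[of 1] state[of 2] cap_pos
    by unfold_locales (auto simp: traffic_state_def)
  interpret J: diverge_junction "C 0" "C 1" "C 2" "D 0" "S 1" "S 2" by (fact J)
  interpret J': diverge_junction "C 0" "C 2" "C 1" "D 0" "S 2" "S 1" by (fact J.swapped)
  have sol: "diverge_solution C U Us Ui \<longleftrightarrow>
    (\<forall>t>0. J.solves (Us 0) (Us 1) (Us 2) (Ui 0 t) (Ui 1 t) (Ui 2 t))"
    using diverge_solution_iff_solves[of 1 2 C U] J init by simp
  have sol': "diverge_solution C U Us Ui \<longleftrightarrow>
    (\<forall>t>0. J'.solves (Us 0) (Us 2) (Us 1) (Ui 0 t) (Ui 2 t) (Ui 1 t))"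
    unfolding sol J.solves_swapped ..
  \<comment> \<open>The stationary states do not depend on time, and there is a positive time to read them off.\<close>
  have time: "(\<forall>t>0. P \<and> Q t) \<longleftrightarrow> P \<and> (\<forall>t>0. Q t)" for P and Q :: "real \<Rightarrow> bool"
    using zero_less_one by blast
  show ?thesis
  proof (intro conjI impI allI, goal_cases)
    case 1
    show ?case
      unfolding sol J.supply_below_demand[OF 1]
      by (simp only: time[symmetric]) auto
  next
    case 2
    show ?case
      unfolding sol J.supply_equals_demand[OF 2] extra_interior_balanced_def
      by (simp only: time[symmetric]) auto
  next
    case 3
    then have "C 1 / (C 1 + C 2) * D 0 < S 1" "C 2 / (C 1 + C 2) * D 0 < S 2" by auto
    then show ?case
      unfolding sol
      by (simp only: J.demand_below_fair_shares time[symmetric]) auto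
  next
    case (4 i j)
    then consider "i = 1" "j = 2" | "i = 2" "j = 1" by (auto simp: doubleton_eq_iff)
    then show ?case
    proof cases
      case 1
      with 4 have "D 0 < S 1 + S 2" "S 1 \<le> C 1 / (C 1 + C 2) * D 0" by auto
      note iff = J.first_supply_below_fair_share[OF this]
      show ?thesis
        unfolding sol iff extra_interior_fair_share_def 1
        by (simp only: time[symmetric])
    next
      case 2
      with 4 have "D 0 < S 2 + S 1" "S 2 \<le> C 2 / (C 2 + C 1) * D 0"
        by (simp_all add: add.commute)
      note iff = J'.first_supply_below_fair_share[OF this, unfolded add.commute[of "C 2" "C 1"]]
      show ?thesis
        unfolding sol' iff extra_interior_fair_share_def 2
        by (simp only: time[symmetric])
    qed
  qed
qed

end
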